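(* Let $A$ be an $n\times n$ Hermitian matrix ($n\ge2$) with eigenvalues $\lambda_1\ge\dots\ge\lambda_n$ and corresponding orthonormal eigenvectors $v_1,\dots,v_n$; write $v_{i,k}$ for the $k$-th component of $v_i$. Fix $k\in\{1,\dots,n\}$ and let $\mu_{k,1}\ge\dots\ge\mu_{k,n-1}$ be the eigenvalues of $A_k$. Set $U^k_\ell:=\sum_{i=\ell}^n|v_{i,k}|^2$ and $L^k_{r+1}:=\sum_{i=1}^{r+1}|v_{i,k}|^2$. Then for all $1\le\ell\le r\le n-1$ with $U^k_\ell\ne0$ and $L^k_{r+1}\ne0$, $$\sum_{j=\ell}^r\lambda_{j+1}+\sum_{j=\ell}^r\frac{|v_{j+1,k}|^2}{L^k_{r+1}}(\lambda_\ell-\lambda_{j+1})\le\sum_{j=\ell}^r\mu_{k,j}\le\sum_{j=\ell}^r\lambda_j-\sum_{j=\ell}^r\frac{|v_{j,k}|^2}{U^k_\ell}(\lambda_j-\lambda_{r+1}).$$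
   Context: For an $n\times n$ matrix $A$ and $k\in\{1,\dots,n\}$, $A_k$ denotes the $(n-1)\times(n-1)$ principal submatrix obtained by deleting the $k$-th row and $k$-th column of $A$. *)

theory Defs
  imports "Jordan_Normal_Form.Schur_Decomposition" "Jordan_Normal_Form.Char_Poly"
begin

definition hermitian_mat :: "complex mat \<Rightarrow> bool" where
  "hermitian_mat A \<longleftrightarrow> dim_row A = dim_col A \<and> mat_adjoint A = A"

(* A_k: principal submatrix deleting the k-th row and column; k is 1-based as in the paper,
   JNF matrices are 0-based. *)
definition principal_del :: "'a mat \<Rightarrow> nat \<Rightarrow> 'a mat" where
  "principal_del A k = mat_delete A (k - 1) (k - 1)"

end

theory Submission
  imports Defs
begin

text \<open>
Let \<open>u\<^sub>1, u\<^sub>2, \<dots>\<close> be orthonormal eigenvectors of the principal submatrix, viewed inside the orthogonal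
complement of the basis vector \<open>e\<^sub>k\<close>. Counting dimensions, one picks orthonormal \<open>x\<^sub>l, \<dots>, x\<^sub>r\<close> with
\<open>x\<^sub>j\<close> in the span of \<open>u\<^sub>1, \<dots>, u\<^sub>j\<close> and orthogonal to \<open>v\<^sub>1, \<dots>, v\<close>\<open>\<^bsub>l-1\<^esub>\<close>; then the Rayleigh quotient of
\<open>x\<^sub>j\<close> is at least \<open>\<mu>\<^sub>j\<close>. All \<open>x\<^sub>j\<close> are also orthogonal to the projection of \<open>e\<^sub>k\<close> onto the span of
\<open>v\<^sub>l, \<dots>, v\<^sub>n\<close>, which has squared norm \<open>U\<close>, so by Bessel's inequality the squared coefficients of the \<open>x\<^sub>j\<close>
along \<open>v\<^sub>i\<close> add up to at most \<open>1 - |v\<^sub>i\<^sub>,\<^sub>k|\<^sup>2 / U\<close>. Subtracting \<open>\<lambda>\<close>\<open>\<^bsub>r+1\<^esub>\<close> from \<open>A\<close> and summing the Rayleigh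
quotients gives the upper bound. The lower bound is the upper bound for \<open>-A\<close>.
\<close>

section \<open>Inner products and orthonormal families\<close>

text \<open>Vectors are plain functions that matter only on \<open>I\<close>, so eigenbasis
  coordinates over \<open>{1..n}\<close> and matrix entries over \<open>{..<N}\<close> share the
  same lemmas. As in \<open>\<bullet>c\<close>, the second argument is conjugated.\<close>

definition cip :: "'i set \<Rightarrow> ('i \<Rightarrow> complex) \<Rightarrow> ('i \<Rightarrow> complex) \<Rightarrow> complex" where
  "cip I x y = (\<Sum>i\<in>I. x i * cnj (y i))"

lemma cip_sum_left: "cip I (\<lambda>i. \<Sum>m\<in>K. c m * g m i) y = (\<Sum>m\<in>K. c m * cip I (g m) y)"
  unfolding cip_def sum_distrib_right sum_distrib_left
  by (subst sum.swap) (simp add: mult_ac)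

lemma cip_scale_left: "cip I (\<lambda>i. s * x i) y = s * cip I x y"
  unfolding cip_def by (simp add: sum_distrib_left mult_ac)

lemma cip_diff_left: "cip I (\<lambda>i. x i - y i) z = cip I x z - cip I y z"
  unfolding cip_def by (simp add: sum_subtractf left_diff_distrib)

lemma cnj_cip: "cnj (cip I x y) = cip I y x"
  unfolding cip_def by (simp add: mult.commute)

lemma cip_cong: "(\<And>i. i \<in> I \<Longrightarrow> x i = x' i) \<Longrightarrow> (\<And>i. i \<in> I \<Longrightarrow> y i = y' i) \<Longrightarrow> cip I x y = cip I x' y'"
  unfolding cip_def by (auto intro!: sum.cong)

lemma cip_self: "cip I x x = of_real (\<Sum>i\<in>I. (cmod (x i))\<^sup>2)"
  unfolding cip_def by (simp only: of_real_sum complex_norm_square)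

lemma homogeneous_nontrivial_solution:
  fixes f :: "nat \<Rightarrow> nat \<Rightarrow> complex"
  assumes "1 \<le> j"
  shows "\<exists>c. (\<exists>m\<in>{1..j}. c m \<noteq> 0) \<and> (\<forall>p\<in>{1..<j}. (\<Sum>m=1..j. c m * f p m) = 0)"
proof -
  \<comment> \<open>Fewer equations than unknowns: a zero row at index 0 completes the
    \<open>j - 1\<close> equations to a singular square matrix. Equation \<open>p\<close> then sits
    in row \<open>p\<close>, and only the unknowns are shifted by one.\<close>
  define M where "M = mat\<^sub>r j j (\<lambda>p. if p = 0 then 0\<^sub>v j else vec j (\<lambda>m. f p (Suc m)))"
  have M: "M \<in> carrier_mat j j" by (simp add: M_def)
  have "det M = 0" unfolding M_def using assms by (intro det_row_0) auto
  then obtain v where v: "v \<in> carrier_vec j" "v \<noteq> 0\<^sub>v j" "M *\<^sub>v v = 0\<^sub>v j"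
    using det_0_iff_vec_prod_zero_field[OF M] by blast
  obtain m where m: "m < j" "v $ m \<noteq> 0" using v(1,2) by (metis carrier_vecD eq_vecI index_zero_vec)
  have "(\<Sum>m=1..j. v $ (m - 1) * f p m) = 0" if p: "p \<in> {1..<j}" for p
  proof -
    have "0 = (M *\<^sub>v v) $ p" using v p by simp
    also have "\<dots> = (\<Sum>m<j. v $ m * f p (Suc m))"
      using p v(1) by (auto simp: M_def scalar_prod_def atLeast0LessThan mult.commute intro!: sum.cong)
    also have "\<dots> = (\<Sum>m=1..j. v $ (m - 1) * f p m)"
      by (rule sum.reindex_bij_witness[of _ "\<lambda>m. m - 1" Suc]) auto
    finally show ?thesis by simp
  qed
  with m show ?thesis by (intro exI[of _ "\<lambda>m. v $ (m - 1)"]) (auto intro!: bexI[of _ "Suc m"])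
qed

text \<open>This is the dimension count behind every choice of a vector below: \<open>j\<close>
  independent vectors always admit a nontrivial combination meeting \<open>j - 1\<close>
  orthogonality conditions. Independence makes it nonzero, so it can be normalised.\<close>

lemma exists_unit_orthogonal_combination:
  fixes g h :: "nat \<Rightarrow> 'i \<Rightarrow> complex"
  assumes fin: "finite I" and j: "1 \<le> j"
    and indep: "\<And>c. (\<forall>i\<in>I. (\<Sum>m=1..j. c m * g m i) = 0) \<Longrightarrow> \<forall>m\<in>{1..j}. c m = 0"
  shows "\<exists>c. cip I (\<lambda>i. \<Sum>m=1..j. c m * g m i) (\<lambda>i. \<Sum>m=1..j. c m * g m i) = 1 \<and>
             (\<forall>p\<in>{1..<j}. cip I (\<lambda>i. \<Sum>m=1..j. c m * g m i) (h p) = 0)"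
proof -
  obtain c where c: "\<exists>m\<in>{1..j}. c m \<noteq> 0" "\<And>p. p \<in> {1..<j} \<Longrightarrow> (\<Sum>m=1..j. c m * cip I (g m) (h p)) = 0"
    using homogeneous_nontrivial_solution[OF j, of "\<lambda>p m. cip I (g m) (h p)"] by blast
  define y where "y = (\<lambda>i. \<Sum>m=1..j. c m * g m i)"
  define s where "s = (\<Sum>i\<in>I. (cmod (y i))\<^sup>2)"
  have "s \<noteq> 0"
  proof
    assume "s = 0"
    then have "\<forall>i\<in>I. y i = 0" using fin by (simp add: s_def sum_nonneg_eq_0_iff)
    with indep c(1) show False unfolding y_def by blast
  qed
  moreover have "s \<ge> 0" unfolding s_def by (simp add: sum_nonneg)
  ultimately have s: "s > 0" by simp
  define d where "d = complex_of_real (1 / sqrt s)"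
  have dy: "(\<lambda>i. \<Sum>m=1..j. d * c m * g m i) = (\<lambda>i. d * y i)"
    by (simp add: y_def sum_distrib_left mult.assoc)
  have "cip I (\<lambda>i. d * y i) (\<lambda>i. d * y i) = d * cnj d * cip I y y"
    unfolding cip_def by (simp add: sum_distrib_left mult_ac)
  also have "\<dots> = of_real (1 / sqrt s * (1 / sqrt s) * s)"
    unfolding cip_self s_def[symmetric] d_def of_real_mult by simp
  also have "1 / sqrt s * (1 / sqrt s) * s = 1" using s by simp
  finally have "cip I (\<lambda>i. d * y i) (\<lambda>i. d * y i) = 1" by simp
  moreover have "cip I (\<lambda>i. d * y i) (h p) = 0" if "p \<in> {1..<j}" for p
    unfolding cip_scale_left unfolding y_def cip_sum_left c(2)[OF that] by simp
  ultimately show ?thesis unfolding dy[symmetric] by (intro exI[of _ "\<lambda>m. d * c m"]) simp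
qed

text \<open>Bessel's inequality for the \<open>i\<close>-th coordinate vector, whose inner products
  with the family are, up to conjugation, the entries \<open>X j i\<close>.\<close>

lemma orthonormal_components_le_1:
  fixes X :: "'j \<Rightarrow> 'i \<Rightarrow> complex"
  assumes fin: "finite I" "finite J" and i: "i \<in> I"
    and orth: "\<And>p q. p \<in> J \<Longrightarrow> q \<in> J \<Longrightarrow> cip I (X p) (X q) = (if p = q then 1 else 0)"
  shows "(\<Sum>j\<in>J. (cmod (X j i))\<^sup>2) \<le> 1"
proof -
  define s where "s = (\<Sum>j\<in>J. (cmod (X j i))\<^sup>2)"
  \<comment> \<open>\<open>y\<close> is the projection of the \<open>i\<close>-th coordinate vector
    onto the span of the family. Both its \<open>i\<close>-th entry and its squared norm equal
    \<open>s\<close>, whence \<open>s * s \<le> s\<close>.\<close>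
  define y where "y = (\<lambda>i'. \<Sum>j\<in>J. cnj (X j i) * X j i')"
  have yi: "y i = of_real s" unfolding y_def s_def
    by (simp add: complex_norm_square mult.commute del: of_real_power)
  have X_y: "cip I (X p) y = X p i" if "p \<in> J" for p
  proof -
    have "cip I y (X p) = (\<Sum>j\<in>J. cnj (X j i) * (if j = p then 1 else 0))"
      unfolding y_def cip_sum_left using that by (intro sum.cong) (auto simp: orth)
    also have "\<dots> = cnj (X p i)" using fin that by (simp add: if_distrib[of "(*) _"] sum.delta cong: if_cong)
    finally show ?thesis by (metis cnj_cip complex_cnj_cnj)
  qed
  have "cip I y y = (\<Sum>j\<in>J. cnj (X j i) * cip I (X j) y)"
    by (subst (1) y_def) (rule cip_sum_left)
  also have "\<dots> = of_real s" unfolding s_def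
    by (simp add: X_y complex_norm_square mult.commute del: of_real_power)
  finally have "(\<Sum>i\<in>I. (cmod (y i))\<^sup>2) = s" unfolding cip_self of_real_eq_iff .
  moreover have "(cmod (y i))\<^sup>2 \<le> (\<Sum>i\<in>I. (cmod (y i))\<^sup>2)"
    using fin i by (intro member_le_sum) auto
  ultimately have "s * s \<le> s" by (simp add: yi power2_eq_square)
  moreover have "s \<ge> 0" by (simp add: s_def sum_nonneg)
  ultimately show ?thesis unfolding s_def[symmetric]
    by (cases "s = 0") (auto simp: mult_le_cancel_right1)
qed

section \<open>Orthonormal eigenvectors of a Hermitian matrix\<close>

text \<open>
The basis in \<open>schur_decomposition\<close> is triangularising but need not be orthonormal. Orthonormalising along
its flag yields eigenvectors: \<open>M y - \<mu> y\<close> lies one step lower in the flag and is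
orthogonal to the eigenvectors already found, which exhaust that step.
\<close>

lemma orthonormal_eigenvectors_of_triangular_basis:
  fixes M :: "'i \<Rightarrow> 'i \<Rightarrow> complex" and P :: "nat \<Rightarrow> 'i \<Rightarrow> complex" and mu :: "nat \<Rightarrow> real"
  assumes fin: "finite I"
    and herm: "\<And>i i'. i \<in> I \<Longrightarrow> i' \<in> I \<Longrightarrow> M i i' = cnj (M i' i)"
    and indep: "\<And>c. (\<forall>i\<in>I. (\<Sum>m=1..N. c m * P m i) = 0) \<Longrightarrow> \<forall>m\<in>{1..N}. c m = 0"
    and tri: "\<And>m i. m \<in> {1..N} \<Longrightarrow> i \<in> I \<Longrightarrow> (\<Sum>i'\<in>I. M i i' * P m i') = (\<Sum>q=1..m. B q m * P q i)"
    and diag: "\<And>m. m \<in> {1..N} \<Longrightarrow> B m m = of_real (mu m)"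
  shows "\<exists>u. (\<forall>p\<in>{1..N}. \<forall>q\<in>{1..N}. cip I (u p) (u q) = (if p = q then 1 else 0)) \<and>
             (\<forall>p\<in>{1..N}. \<forall>i\<in>I. (\<Sum>i'\<in>I. M i i' * u p i') = of_real (mu p) * u p i)"
proof -
  define app where "app x = (\<lambda>i. \<Sum>i'\<in>I. M i i' * x i')" for x
  have app_adj: "cip I (app x) y = cip I x (app y)" for x y
  proof -
    have "cip I (app x) y = (\<Sum>i\<in>I. \<Sum>i'\<in>I. M i i' * x i' * cnj (y i))"
      unfolding cip_def app_def by (simp add: sum_distrib_right)
    also have "\<dots> = (\<Sum>i\<in>I. \<Sum>i'\<in>I. x i' * cnj (M i' i * y i))"
      by (intro sum.cong refl, subst herm) (simp_all add: mult_ac)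
    also have "\<dots> = cip I x (app y)"
      unfolding cip_def app_def by (subst sum.swap) (simp add: sum_distrib_left)
    finally show ?thesis .
  qed
  have indep_le: "\<forall>m\<in>{1..t}. c m = 0"
    if t: "t \<le> N" and 0: "\<forall>i\<in>I. (\<Sum>m=1..t. c m * P m i) = 0" for t c
  proof -
    have "(\<Sum>m=1..N. (if m \<le> t then c m else 0) * P m i) = (\<Sum>m=1..t. c m * P m i)" for i
      using t by (intro sum.mono_neutral_cong_right) auto
    with 0 have "\<forall>m\<in>{1..N}. (if m \<le> t then c m else 0) = 0" by (intro indep) simp
    with t show ?thesis by (metis atLeastAtMost_iff order_trans)
  qed
  \<comment> \<open>The third conjunct expresses that \<open>u 1, ..., u t\<close> exhaust step
    \<open>t\<close> of the flag: nothing in the span of \<open>P 1, ..., P t\<close> other than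
    zero is orthogonal to all of them.\<close>
  have "\<exists>u. (\<forall>p\<in>{1..t}. \<forall>q\<in>{1..t}. cip I (u p) (u q) = (if p = q then 1 else 0)) \<and>
            (\<forall>p\<in>{1..t}. \<forall>i\<in>I. app (u p) i = of_real (mu p) * u p i) \<and>
            (\<forall>c. (\<forall>p\<in>{1..t}. cip I (\<lambda>i. \<Sum>m=1..t. c m * P m i) (u p) = 0)
               \<longrightarrow> (\<forall>i\<in>I. (\<Sum>m=1..t. c m * P m i) = 0))" if "t \<le> N" for t
    using that
  proof (induction t)
    case 0
    show ?case by simp
  next
    case (Suc t)
    from Suc.IH[OF Suc_leD[OF Suc.prems]] obtain u where orth: "\<And>p q. p \<in> {1..t} \<Longrightarrow> q \<in> {1..t} \<Longrightarrow> cip I (u p) (u q) = (if p = q then 1 else 0)"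
      and eig: "\<And>p i. p \<in> {1..t} \<Longrightarrow> i \<in> I \<Longrightarrow> app (u p) i = of_real (mu p) * u p i"
      and total: "\<And>c i. (\<forall>p\<in>{1..t}. cip I (\<lambda>i. \<Sum>m=1..t. c m * P m i) (u p) = 0) \<Longrightarrow> i \<in> I
                    \<Longrightarrow> (\<Sum>m=1..t. c m * P m i) = 0"
      by blast
    have pos: "1 \<le> Suc t" by simp
    obtain c where c: "cip I (\<lambda>i. \<Sum>m=1..Suc t. c m * P m i) (\<lambda>i. \<Sum>m=1..Suc t. c m * P m i) = 1"
      "\<And>p. p \<in> {1..<Suc t} \<Longrightarrow> cip I (\<lambda>i. \<Sum>m=1..Suc t. c m * P m i) (u p) = 0"
      using exists_unit_orthogonal_combination[OF fin pos indep_le[OF Suc.prems], where h = u] by blast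
    define y where "y = (\<lambda>i. \<Sum>m=1..Suc t. c m * P m i)"
    have y1: "cip I y y = 1" and y0: "\<And>p. p \<in> {1..t} \<Longrightarrow> cip I y (u p) = 0"
      using c unfolding y_def by auto
    have y0': "cip I (u p) y = 0" if "p \<in> {1..t}" for p
      using y0[OF that] by (metis cnj_cip complex_cnj_zero)
    \<comment> \<open>Otherwise \<open>y\<close> would already lie in step \<open>t\<close> while
      being orthogonal to all of \<open>u 1, ..., u t\<close>, hence vanish by
      \<open>total\<close>.\<close>
    have ct: "c (Suc t) \<noteq> 0"
    proof
      assume c0: "c (Suc t) = 0"
      have "y i = 0" if "i \<in> I" for i
        using total[of c i] y0 that unfolding y_def by (simp add: c0)
      then have "cip I y y = 0" unfolding cip_def by simp
      with y1 show False by simp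
    qed
    have eig_y: "app y i = of_real (mu (Suc t)) * y i" if i: "i \<in> I" for i
    proof -
      \<comment> \<open>Coefficients of \<open>M y - mu (Suc t) y\<close> in the triangular basis.
        The top one is zero because \<open>B (Suc t) (Suc t)\<close> equals
        \<open>mu (Suc t)\<close>, so the difference drops to step \<open>t\<close>.\<close>
      define d where "d = (\<lambda>q. (\<Sum>m=q..Suc t. c m * B q m) - of_real (mu (Suc t)) * c q)"
      have expand: "app y i - of_real (mu (Suc t)) * y i = (\<Sum>q=1..t. d q * P q i)" if "i \<in> I" for i
      proof -
        have "app y i = (\<Sum>m=1..Suc t. c m * (\<Sum>i'\<in>I. M i i' * P m i'))"
          unfolding app_def y_def sum_distrib_left by (subst sum.swap) (simp add: mult_ac)
        also have "\<dots> = (\<Sum>m=1..Suc t. \<Sum>q=1..m. c m * (B q m * P q i))"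
          using Suc.prems that by (intro sum.cong) (auto simp: tri sum_distrib_left)
        also have "\<dots> = (\<Sum>q=1..Suc t. \<Sum>m=q..Suc t. c m * (B q m * P q i))"
          unfolding sum.Sigma[OF finite_atLeastAtMost ballI[OF finite_atLeastAtMost]]
          by (rule sum.reindex_bij_witness[of _ "\<lambda>(q, m). (m, q)" "\<lambda>(m, q). (q, m)"]) auto
        also have "\<dots> = (\<Sum>q=1..Suc t. (\<Sum>m=q..Suc t. c m * B q m) * P q i)"
          by (simp only: sum_distrib_right mult.assoc)
        finally have "app y i - of_real (mu (Suc t)) * y i = (\<Sum>q=1..Suc t. d q * P q i)"
          unfolding y_def sum_distrib_left d_def by (simp add: sum_subtractf left_diff_distrib mult.assoc del: sum.cl_ivl_Suc)
        moreover have "d (Suc t) = 0" unfolding d_def using diag[of "Suc t"] Suc.prems by simp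
        ultimately show ?thesis by simp
      qed
      \<comment> \<open>Self-adjointness moves \<open>app\<close> onto the eigenvector
        \<open>u p\<close>, to which \<open>y\<close> is orthogonal.\<close>
      have "cip I (\<lambda>i. \<Sum>q=1..t. d q * P q i) (u p) = 0" if p: "p \<in> {1..t}" for p
      proof -
        have "cip I (\<lambda>i. \<Sum>q=1..t. d q * P q i) (u p) = cip I (\<lambda>i. app y i - of_real (mu (Suc t)) * y i) (u p)"
          using expand by (intro cip_cong) auto
        also have "\<dots> = cip I y (app (u p))"
          unfolding cip_diff_left cip_scale_left y0[OF p] app_adj by simp
        also have "\<dots> = cip I y (\<lambda>i. of_real (mu p) * u p i)"
          using eig[OF p] by (intro cip_cong) auto
        also have "\<dots> = cnj (of_real (mu p) * cip I (u p) y)"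
          by (subst cip_scale_left[symmetric], subst cnj_cip) simp
        also have "\<dots> = 0" using y0'[OF p] by simp
        finally show ?thesis .
      qed
      then show ?thesis using total[of d i] expand[OF i] i by simp
    qed
    have total': "(\<Sum>m=1..Suc t. e m * P m i) = 0"
      if e0: "\<forall>p\<in>{1..Suc t}. cip I (\<lambda>i. \<Sum>m=1..Suc t. e m * P m i) ((u(Suc t := y)) p) = 0" and i: "i \<in> I" for e i
    proof -
      \<comment> \<open>This multiple of \<open>y\<close> cancels the \<open>P (Suc t)\<close> term
        of \<open>z\<close>, so \<open>z - s y\<close> lies in step \<open>t\<close> and vanishes by
        \<open>total\<close>. Pairing \<open>z = s y\<close> with \<open>y\<close> then forces
        \<open>s = 0\<close>.\<close>
      define s where "s = e (Suc t) / c (Suc t)"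
      define z where "z = (\<lambda>i. \<Sum>m=1..Suc t. e m * P m i)"
      have z_y: "cip I z y = 0" using e0 unfolding z_def by force
      have z_u: "cip I z (u p) = 0" if "p \<in> {1..t}" for p
        using e0[rule_format, of p] that unfolding z_def by auto
      have zsy: "z i - s * y i = (\<Sum>m=1..t. (e m - s * c m) * P m i)" for i
        using ct unfolding z_def y_def
        by (simp add: s_def sum_subtractf left_diff_distrib right_diff_distrib sum_distrib_left distrib_left mult.assoc)
      have "cip I (\<lambda>i. \<Sum>m=1..t. (e m - s * c m) * P m i) (u p) = 0" if "p \<in> {1..t}" for p
        unfolding zsy[symmetric] cip_diff_left cip_scale_left using y0 z_u that by simp
      then have zy: "z i = s * y i" if "i \<in> I" for i
        using total[of "\<lambda>m. e m - s * c m" i] that unfolding zsy[symmetric] by simp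
      have "cip I z y = s * cip I y y"
        unfolding cip_scale_left[symmetric] using zy by (intro cip_cong) auto
      then have "s = 0" using z_y y1 by simp
      then show ?thesis using zy[OF i] unfolding z_def by simp
    qed
    show ?case
    proof (intro exI[of _ "u(Suc t := y)"] conjI)
      show "\<forall>p\<in>{1..Suc t}. \<forall>q\<in>{1..Suc t}. cip I ((u(Suc t := y)) p) ((u(Suc t := y)) q) = (if p = q then 1 else 0)"
        using orth y1 y0 y0' by (auto simp: le_Suc_eq)
      show "\<forall>p\<in>{1..Suc t}. \<forall>i\<in>I. app ((u(Suc t := y)) p) i = of_real (mu p) * (u(Suc t := y)) p i"
        using eig eig_y by (auto simp: le_Suc_eq)
      show "\<forall>c. (\<forall>p\<in>{1..Suc t}. cip I (\<lambda>i. \<Sum>m=1..Suc t. c m * P m i) ((u(Suc t := y)) p) = 0)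
               \<longrightarrow> (\<forall>i\<in>I. (\<Sum>m=1..Suc t. c m * P m i) = 0)"
        using total' by blast
    qed
  qed
  from this[of N] show ?thesis unfolding app_def by blast
qed


lemma hermitian_mat_index:
  assumes A: "A \<in> carrier_mat n n" "hermitian_mat A" and ij: "i < n" "j < n"
  shows "A $$ (i, j) = cnj (A $$ (j, i))"
proof -
  have "A $$ (i, j) = mat_adjoint A $$ (i, j)" using A by (simp add: hermitian_mat_def)
  also have "\<dots> = cnj (A $$ (j, i))" using A(1) ij by (simp add: mat_adjoint_def mat_of_rows_index)
  finally show ?thesis .
qed

text \<open>A Schur decomposition gives \<open>M * P = P * B\<close> with \<open>B\<close> upper
  triangular and \<open>P\<close> invertible, so the columns of \<open>P\<close> form the triangular
  basis required above.\<close>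

lemma hermitian_orthonormal_eigenvectors:
  fixes M :: "complex mat" and mu :: "nat \<Rightarrow> real"
  assumes M: "M \<in> carrier_mat N N"
    and herm: "\<And>i j. i < N \<Longrightarrow> j < N \<Longrightarrow> M $$ (i, j) = cnj (M $$ (j, i))"
    and cp: "char_poly M = (\<Prod>j = 1..N. [:- complex_of_real (mu j), 1:])"
  shows "\<exists>u. (\<forall>p\<in>{1..N}. \<forall>q\<in>{1..N}. cip {..<N} (u p) (u q) = (if p = q then 1 else 0)) \<and>
             (\<forall>p\<in>{1..N}. \<forall>i\<in>{..<N}. (\<Sum>i'<N. M $$ (i, i') * u p i') = of_real (mu p) * u p i)"
proof -
  \<comment> \<open>The order of this list becomes the order of the diagonal of \<open>B\<close>,
    which ties the \<open>p\<close>-th eigenvector to \<open>mu p\<close>.\<close>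
  define es where "es = map (\<lambda>j. complex_of_real (mu j)) [1..<Suc N]"
  have "(\<Prod>e\<leftarrow>es. [:- e, 1:]) = (\<Prod>j\<leftarrow>[1..<Suc N]. [:- complex_of_real (mu j), 1:])"
    unfolding es_def map_map comp_def ..
  also have "\<dots> = (\<Prod>j = 1..N. [:- complex_of_real (mu j), 1:])"
    by (subst prod.distinct_set_conv_list[symmetric]) (simp_all add: atLeastLessThanSuc_atLeastAtMost del: upt_Suc)
  finally have cp': "char_poly M = (\<Prod>e\<leftarrow>es. [:- e, 1:])" using cp by simp
  obtain B P Q where "schur_decomposition M es = (B, P, Q)" by (metis prod_cases3)
  from schur_decomposition[OF M cp' this]
  have wit: "similar_mat_wit M B P Q" and ut: "upper_triangular B" and dB: "diag_mat B = es" by auto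
  note w = similar_mat_witD2[OF M wit]
  have "M * P = P * B * (Q * P)" unfolding w(3) using w by (simp add: assoc_mult_mat[of _ N N _ N _ N])
  then have MP: "M * P = P * B" using w by simp
  show ?thesis
  proof (rule orthonormal_eigenvectors_of_triangular_basis
      [where M = "\<lambda>i j. M $$ (i, j)" and P = "\<lambda>m i. P $$ (i, m - 1)" and B = "\<lambda>q m. B $$ (q - 1, m - 1)"])
    show "M $$ (i, i') = cnj (M $$ (i', i))" if "i \<in> {..<N}" "i' \<in> {..<N}" for i i'
      using that by (intro herm) auto
    show "\<forall>m\<in>{1..N}. c m = 0" if c: "\<forall>i\<in>{..<N}. (\<Sum>m=1..N. c m * P $$ (i, m - 1)) = 0" for c
    proof
      fix m assume m: "m \<in> {1..N}"
      define x where "x = vec N (\<lambda>m. c (Suc m))"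
      have x: "x \<in> carrier_vec N" by (simp add: x_def)
      have "P *\<^sub>v x = 0\<^sub>v N"
      proof (intro eq_vecI)
        fix i assume i: "i < dim_vec (0\<^sub>v N :: complex vec)"
        have "(P *\<^sub>v x) $ i = (\<Sum>m<N. c (Suc m) * P $$ (i, m))"
          using i w(6) by (auto simp: x_def scalar_prod_def atLeast0LessThan mult.commute intro!: sum.cong)
        also have "\<dots> = (\<Sum>m=1..N. c m * P $$ (i, m - 1))"
          by (rule sum.reindex_bij_witness[of _ "\<lambda>m. m - 1" Suc]) auto
        finally show "(P *\<^sub>v x) $ i = 0\<^sub>v N $ i" using c i by simp
      qed (use w(6) in auto)
      then have "(Q * P) *\<^sub>v x = 0\<^sub>v N" unfolding assoc_mult_mat_vec[OF w(7) w(6) x] using w(7) by auto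
      then have "x = 0\<^sub>v N" unfolding w(2) using x by simp
      then have "x $ (m - 1) = 0" using m by auto
      then show "c m = 0" using m by (auto simp: x_def)
    qed
    show "(\<Sum>i'<N. M $$ (i, i') * P $$ (i', m - 1)) = (\<Sum>q=1..m. B $$ (q - 1, m - 1) * P $$ (i, q - 1))"
      if m: "m \<in> {1..N}" and i: "i \<in> {..<N}" for m i
    proof -
      have "(\<Sum>i'<N. M $$ (i, i') * P $$ (i', m - 1)) = (M * P) $$ (i, m - 1)"
        using m i w by (auto simp: scalar_prod_def atLeast0LessThan intro!: sum.cong)
      also have "\<dots> = (\<Sum>q<N. P $$ (i, q) * B $$ (q, m - 1))"
        unfolding MP using m i w by (auto simp: scalar_prod_def atLeast0LessThan intro!: sum.cong)
      also have "\<dots> = (\<Sum>q<m. P $$ (i, q) * B $$ (q, m - 1))"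
        using m w(5) by (intro sum.mono_neutral_right) (auto intro!: upper_triangularD[OF ut])
      also have "\<dots> = (\<Sum>q=1..m. B $$ (q - 1, m - 1) * P $$ (i, q - 1))"
        by (rule sum.reindex_bij_witness[of _ "\<lambda>m. m - 1" Suc]) auto
      finally show ?thesis .
    qed
    show "B $$ (m - 1, m - 1) = complex_of_real (mu m)" if m: "m \<in> {1..N}" for m
    proof -
      have "B $$ (m - 1, m - 1) = diag_mat B ! (m - 1)" using m w(5) by (auto simp: diag_mat_def)
      also have "\<dots> = complex_of_real (mu m)" unfolding dB es_def using m by (auto simp del: upt_Suc)
      finally show ?thesis .
    qed
  qed simp
qed

section \<open>The upper bound in eigenbasis coordinates\<close>

text \<open>Parseval's identity for a diagonal form: all mixed terms vanish. Weights 1 give the norm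
  of a combination, weights \<open>lam\<close> its Rayleigh quotient.\<close>

lemma weighted_square_of_combination:
  fixes a :: "nat \<Rightarrow> 'i \<Rightarrow> complex" and w :: "'i \<Rightarrow> real" and nu :: "nat \<Rightarrow> real"
  assumes "finite K"
    and "\<And>p q. p \<in> K \<Longrightarrow> q \<in> K \<Longrightarrow> (\<Sum>i\<in>I. of_real (w i) * a p i * cnj (a q i)) = (if p = q then of_real (nu p) else 0)"
  shows "(\<Sum>i\<in>I. w i * (cmod (\<Sum>m\<in>K. c m * a m i))\<^sup>2) = (\<Sum>m\<in>K. nu m * (cmod (c m))\<^sup>2)"
proof -
  have "complex_of_real (\<Sum>i\<in>I. w i * (cmod (\<Sum>m\<in>K. c m * a m i))\<^sup>2)
      = (\<Sum>i\<in>I. of_real (w i) * ((\<Sum>p\<in>K. c p * a p i) * (\<Sum>q\<in>K. cnj (c q) * cnj (a q i))))"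
    by (simp only: of_real_sum of_real_mult complex_norm_square cnj_sum complex_cnj_mult)
  also have "\<dots> = (\<Sum>i\<in>I. \<Sum>p\<in>K. \<Sum>q\<in>K. c p * cnj (c q) * (of_real (w i) * a p i * cnj (a q i)))"
    unfolding sum_product unfolding sum_distrib_left by (intro sum.cong refl) (simp only: mult_ac)
  also have "\<dots> = (\<Sum>p\<in>K. \<Sum>q\<in>K. c p * cnj (c q) * (\<Sum>i\<in>I. of_real (w i) * a p i * cnj (a q i)))"
    unfolding sum_distrib_left by (subst sum.swap, intro sum.cong refl, rule sum.swap)
  also have "\<dots> = (\<Sum>p\<in>K. \<Sum>q\<in>K. if q = p then of_real (nu p) * (c p * cnj (c p)) else 0)"
    using assms(2) by (intro sum.cong refl) auto
  also have "\<dots> = (\<Sum>p\<in>K. of_real (nu p) * (c p * cnj (c p)))"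
    using assms(1) by simp
  also have "\<dots> = complex_of_real (\<Sum>m\<in>K. nu m * (cmod (c m))\<^sup>2)"
    by (simp only: of_real_sum of_real_mult complex_norm_square)
  finally show ?thesis unfolding of_real_eq_iff .
qed

lemma cip_left_unit: "finite I \<Longrightarrow> p \<in> I \<Longrightarrow> cip I x (\<lambda>i. if i = p then 1 else 0) = x p"
  unfolding cip_def by (simp add: if_distrib[of cnj] if_distrib[of "(*) _"] sum.delta cong: if_cong)

text \<open>
Everything is expressed in the eigenbasis of the large matrix: \<open>a j i\<close> is the coefficient of the \<open>j\<close>-th
eigenvector of the submatrix along \<open>v\<^sub>i\<close>, and \<open>b i\<close> is the \<open>k\<close>-th entry of \<open>v\<^sub>i\<close>.
\<close>

lemma compression_partial_sum_upper_bound: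
  fixes lam mu :: "nat \<Rightarrow> real" and a :: "nat \<Rightarrow> nat \<Rightarrow> complex" and b :: "nat \<Rightarrow> complex"
  assumes orth: "\<And>p q. p \<in> {1..<n} \<Longrightarrow> q \<in> {1..<n} \<Longrightarrow> cip {1..n} (a p) (a q) = (if p = q then 1 else 0)"
    and diag: "\<And>p q. p \<in> {1..<n} \<Longrightarrow> q \<in> {1..<n} \<Longrightarrow>
                 (\<Sum>i=1..n. of_real (lam i) * a p i * cnj (a q i)) = (if p = q then of_real (mu p) else 0)"
    and annih: "\<And>p. p \<in> {1..<n} \<Longrightarrow> (\<Sum>i=1..n. a p i * b i) = 0"
    and lam_sorted: "\<And>i j. 1 \<le> i \<Longrightarrow> i \<le> j \<Longrightarrow> j \<le> n \<Longrightarrow> lam j \<le> lam i"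
    and mu_sorted: "\<And>i j. 1 \<le> i \<Longrightarrow> i \<le> j \<Longrightarrow> j < n \<Longrightarrow> mu j \<le> mu i"
    and lr: "1 \<le> l" "l \<le> r" "r < n"
    and U: "(\<Sum>i=l..n. (cmod (b i))\<^sup>2) \<noteq> 0"
  shows "(\<Sum>j=l..r. mu j) \<le> (\<Sum>j=l..r. lam j)
           - (\<Sum>j=l..r. (cmod (b j))\<^sup>2 / (\<Sum>i=l..n. (cmod (b i))\<^sup>2) * (lam j - lam (r + 1)))"
proof -
  let ?I = "{1..n}"
  \<comment> \<open>The family starts with the first \<open>l - 1\<close> coordinate vectors, so that orthonormality alone makes
    the later members vanish there.\<close>
  define good where "good j y \<longleftrightarrow> (\<Sum>i=1..n. y i * b i) = 0 \<and> mu j \<le> (\<Sum>i=1..n. lam i * (cmod (y i))\<^sup>2)"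
    for j and y :: "nat \<Rightarrow> complex"
  have "\<exists>x. (\<forall>p\<in>{1..t}. \<forall>q\<in>{1..t}. cip ?I (x p) (x q) = (if p = q then 1 else 0)) \<and>
            (\<forall>p\<in>{1..<l}. x p = (\<lambda>i. if i = p then 1 else 0)) \<and> (\<forall>p\<in>{l..t}. good p (x p))"
    if "l - 1 \<le> t" "t \<le> r" for t
    using that
  proof (induction t rule: dec_induct)
    \<comment> \<open>At \<open>t = l - 1\<close> the family consists of coordinate vectors only,
      and the range \<open>{l..t}\<close> is empty.\<close>
    case base
    show ?case
      using lr by (intro exI[of _ "\<lambda>p i. if i = p then 1 else 0"]) (auto simp: cip_left_unit)
  next
    case (step t)
    from step.IH[OF Suc_leD[OF step.prems]] obtain x where x: "\<forall>p\<in>{1..t}. \<forall>q\<in>{1..t}. cip ?I (x p) (x q) = (if p = q then 1 else 0)"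
      "\<forall>p\<in>{1..<l}. x p = (\<lambda>i. if i = p then 1 else 0)" "\<forall>p\<in>{l..t}. good p (x p)"
      by blast
    have lt: "l \<le> Suc t" and tn: "Suc t < n" using step lr by auto
    have indep: "\<forall>m\<in>{1..Suc t}. c m = 0" if c: "\<forall>i\<in>?I. (\<Sum>m=1..Suc t. c m * a m i) = 0" for c
    proof
      fix q assume q: "q \<in> {1..Suc t}"
      have "0 = cip ?I (\<lambda>i. \<Sum>m=1..Suc t. c m * a m i) (a q)"
        unfolding cip_def using c by simp
      also have "\<dots> = (\<Sum>m=1..Suc t. if m = q then c m else 0)"
        unfolding cip_sum_left using q tn by (intro sum.cong) (auto simp: orth simp del: One_nat_def)
      also have "\<dots> = c q" using q by (simp del: sum.cl_ivl_Suc)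
      finally show "c q = 0" by simp
    qed
    have pos: "1 \<le> Suc t" by simp
    \<comment> \<open>Orthogonality to \<open>x 1, ..., x t\<close> imposes \<open>t\<close>
      conditions on \<open>Suc t\<close> independent vectors; the coordinate vectors and the members
      already chosen are treated alike.\<close>
    obtain c where c: "cip ?I (\<lambda>i. \<Sum>m=1..Suc t. c m * a m i) (\<lambda>i. \<Sum>m=1..Suc t. c m * a m i) = 1"
      "\<And>p. p \<in> {1..<Suc t} \<Longrightarrow> cip ?I (\<lambda>i. \<Sum>m=1..Suc t. c m * a m i) (x p) = 0"
      using exists_unit_orthogonal_combination[OF finite_atLeastAtMost pos indep, where h = x] by blast
    define y where "y = (\<lambda>i. \<Sum>m=1..Suc t. c m * a m i)"
    have y1: "cip ?I y y = 1" and y0: "\<And>p. p \<in> {1..t} \<Longrightarrow> cip ?I y (x p) = 0"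
      using c unfolding y_def by auto
    have y0': "cip ?I (x p) y = 0" if "p \<in> {1..t}" for p
      using y0[OF that] by (metis cnj_cip complex_cnj_zero)
    have "(\<Sum>i=1..n. y i * b i) = (\<Sum>m=1..Suc t. c m * (\<Sum>i=1..n. a m i * b i))"
      unfolding y_def sum_distrib_left sum_distrib_right by (subst sum.swap) (simp only: mult_ac)
    also have "\<dots> = 0" using tn annih by (intro sum.neutral) auto
    finally have yb: "(\<Sum>i=1..n. y i * b i) = 0" .
    have "(\<Sum>m=1..Suc t. (cmod (c m))\<^sup>2) = (\<Sum>i=1..n. (cmod (y i))\<^sup>2)"
      unfolding y_def
      using weighted_square_of_combination[where K = "{1..Suc t}" and I = ?I and w = "\<lambda>_. 1" and a = a and nu = "\<lambda>_. 1" and c = c] orth tn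
      by (simp add: cip_def del: sum.cl_ivl_Suc One_nat_def)
    also have "\<dots> = 1" using y1 unfolding cip_self by (metis of_real_eq_1_iff)
    finally have c1: "(\<Sum>m=1..Suc t. (cmod (c m))\<^sup>2) = 1" .
    \<comment> \<open>The Rayleigh quotient of \<open>y\<close> is an average of
      \<open>mu 1, ..., mu (Suc t)\<close> with weights \<open>(cmod (c m))\<^sup>2\<close>, hence
      at least the smallest of them.\<close>
    have "mu (Suc t) = (\<Sum>m=1..Suc t. mu (Suc t) * (cmod (c m))\<^sup>2)"
      unfolding sum_distrib_left[symmetric] c1 by simp
    also have "\<dots> \<le> (\<Sum>m=1..Suc t. mu m * (cmod (c m))\<^sup>2)"
      using tn by (intro sum_mono mult_right_mono mu_sorted) auto
    also have "\<dots> = (\<Sum>i=1..n. lam i * (cmod (y i))\<^sup>2)"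
      unfolding y_def using tn diag
      by (intro weighted_square_of_combination[symmetric]) auto
    finally have "good (Suc t) y" unfolding good_def using yb by simp
    show ?case
    proof (intro exI[of _ "x(Suc t := y)"] conjI)
      show "\<forall>p\<in>{1..Suc t}. \<forall>q\<in>{1..Suc t}. cip ?I ((x(Suc t := y)) p) ((x(Suc t := y)) q) = (if p = q then 1 else 0)"
        using x(1) y1 y0 y0' by (auto simp: le_Suc_eq simp del: One_nat_def)
      show "\<forall>p\<in>{1..<l}. (x(Suc t := y)) p = (\<lambda>i. if i = p then 1 else 0)"
        using x(2) lt by auto
      show "\<forall>p\<in>{l..Suc t}. good p ((x(Suc t := y)) p)"
        using x(3) \<open>good (Suc t) y\<close> by (auto simp: le_Suc_eq)
    qed
  qed
  from this[of r] lr obtain x where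
      x_orth: "\<And>p q. p \<in> {1..r} \<Longrightarrow> q \<in> {1..r} \<Longrightarrow> cip ?I (x p) (x q) = (if p = q then 1 else 0)"
    and x_unit: "\<And>p. p \<in> {1..<l} \<Longrightarrow> x p = (\<lambda>i. if i = p then 1 else 0)"
    and x_good: "\<And>p. p \<in> {l..r} \<Longrightarrow> good p (x p)"
    by force
  have x0: "x j i = 0" if "j \<in> {l..r}" "i \<in> {1..<l}" for i j
  proof -
    have "x j i = cip ?I (x j) (x i)" using that lr by (simp add: x_unit cip_left_unit)
    also have "\<dots> = 0" using that lr by (subst x_orth) auto
    finally show ?thesis .
  qed
  have x1: "(\<Sum>i=1..n. (cmod (x j i))\<^sup>2) = 1" if "j \<in> {l..r}" for j
  proof -
    have "cip ?I (x j) (x j) = 1" using that lr by (simp add: x_orth del: One_nat_def)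
    then show ?thesis unfolding cip_self by (metis of_real_eq_1_iff)
  qed
  define S where "S = (\<Sum>i=l..n. (cmod (b i))\<^sup>2)"
  have S: "S > 0" using U unfolding S_def by (simp add: sum_nonneg order.not_eq_order_implies_strict)
  \<comment> \<open>The \<open>k\<close>-th basis vector has eigenbasis coefficients
    \<open>cnj (b i)\<close>. Cutting these off below \<open>l\<close> and dividing by
    \<open>sqrt S\<close> gives the unit vector along its projection.\<close>
  define e where "e = (\<lambda>i. if l \<le> i then cnj (b i) / of_real (sqrt S) else 0)"
  have cmod_e: "(cmod (e i))\<^sup>2 = (if l \<le> i then (cmod (b i))\<^sup>2 / S else 0)" for i
    using S by (simp add: e_def norm_divide power_divide)
  have "(\<Sum>i=1..n. (cmod (e i))\<^sup>2) = (\<Sum>i=l..n. (cmod (b i))\<^sup>2 / S)"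
    unfolding cmod_e using lr by (intro sum.mono_neutral_cong_right) auto
  also have "\<dots> = 1" unfolding sum_divide_distrib[symmetric] S_def[symmetric] using S by simp
  finally have e1: "cip ?I e e = 1" unfolding cip_self by simp
  \<comment> \<open>The cut-off changes nothing here: \<open>x j\<close> vanishes below
    \<open>l\<close>, so the annihilation condition in \<open>good\<close> becomes orthogonality to
    \<open>e\<close>.\<close>
  have xe: "cip ?I (x j) e = 0" if j: "j \<in> {l..r}" for j
  proof -
    have "cip ?I (x j) e = (\<Sum>i=1..n. x j i * b i / of_real (sqrt S))"
      unfolding cip_def using x0[OF j] by (intro sum.cong) (auto simp: e_def)
    also have "\<dots> = 0" unfolding sum_divide_distrib[symmetric] using x_good[OF j] by (simp add: good_def)
    finally show ?thesis .
  qed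
  have ex: "cip ?I e (x j) = 0" if "j \<in> {l..r}" for j
    using xe[OF that] by (metis cnj_cip complex_cnj_zero)
  have bessel: "(\<Sum>j=l..r. (cmod (x j i))\<^sup>2) \<le> 1 - (cmod (b i))\<^sup>2 / S" if i: "i \<in> {l..r}" for i
  proof -
    \<comment> \<open>Index 0 is free for \<open>e\<close> because \<open>l\<close> is at least 1.
      Its share of the Bessel sum is the gain \<open>(cmod (b i))\<^sup>2 / S\<close>.\<close>
    define X where "X j = (if j = 0 then e else x j)" for j
    have "(\<Sum>j\<in>insert 0 {l..r}. (cmod (X j i))\<^sup>2) \<le> 1"
      using i lr e1 xe ex x_orth
      by (intro orthonormal_components_le_1[where I = ?I]) (auto simp: X_def simp del: One_nat_def)
    moreover have "(\<Sum>j\<in>insert 0 {l..r}. (cmod (X j i))\<^sup>2) = (cmod (e i))\<^sup>2 + (\<Sum>j=l..r. (cmod (x j i))\<^sup>2)"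
      using lr by (subst sum.insert) (auto simp: X_def intro!: sum.cong)
    ultimately show ?thesis using i by (simp add: cmod_e)
  qed
  define d where "d i = lam i - lam (r + 1)" for i
  have "(\<Sum>j=l..r. mu j - lam (r + 1)) \<le> (\<Sum>j=l..r. \<Sum>i=l..r. d i * (cmod (x j i))\<^sup>2)"
  proof (rule sum_mono)
    fix j assume j: "j \<in> {l..r}"
    have "mu j - lam (r + 1) \<le> (\<Sum>i=1..n. lam i * (cmod (x j i))\<^sup>2) - lam (r + 1) * (\<Sum>i=1..n. (cmod (x j i))\<^sup>2)"
      using x_good[OF j] x1[OF j] by (simp add: good_def)
    also have "\<dots> = (\<Sum>i=1..n. d i * (cmod (x j i))\<^sup>2)"
      by (simp add: d_def sum_distrib_left sum_subtractf left_diff_distrib)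
    also have "\<dots> \<le> (\<Sum>i=1..n. if i \<in> {l..r} then d i * (cmod (x j i))\<^sup>2 else 0)"
    proof (rule sum_mono)
      fix i assume i: "i \<in> {1..n}"
      have "d i * (cmod (x j i))\<^sup>2 \<le> 0" if "i \<notin> {l..r}"
      proof (cases "i < l")
        case True
        then show ?thesis using x0[OF j] i by simp
      next
        case False
        with that i have "d i \<le> 0" using lam_sorted[of "r + 1" i] by (simp add: d_def)
        then show ?thesis by (simp add: mult_nonpos_nonneg)
      qed
      then show "d i * (cmod (x j i))\<^sup>2 \<le> (if i \<in> {l..r} then d i * (cmod (x j i))\<^sup>2 else 0)" by auto
    qed
    also have "\<dots> = (\<Sum>i=l..r. d i * (cmod (x j i))\<^sup>2)"
      using lr by (intro sum.mono_neutral_cong_right) auto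
    finally show "mu j - lam (r + 1) \<le> (\<Sum>i=l..r. d i * (cmod (x j i))\<^sup>2)" .
  qed
  also have "\<dots> = (\<Sum>i=l..r. d i * (\<Sum>j=l..r. (cmod (x j i))\<^sup>2))"
    unfolding sum_distrib_left by (rule sum.swap)
  also have "\<dots> \<le> (\<Sum>i=l..r. d i * (1 - (cmod (b i))\<^sup>2 / S))"
  proof (intro sum_mono mult_left_mono bessel)
    fix i assume "i \<in> {l..r}"
    then show "0 \<le> d i" using lam_sorted[of i "r + 1"] lr by (simp add: d_def)
  qed
  also have "\<dots> = (\<Sum>j=l..r. lam j - lam (r + 1)) - (\<Sum>j=l..r. (cmod (b j))\<^sup>2 / S * (lam j - lam (r + 1)))"
    unfolding sum_subtractf[symmetric] d_def by (intro sum.cong) (simp_all add: algebra_simps)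
  finally show ?thesis unfolding S_def[symmetric] by (simp add: sum_subtractf)
qed

section \<open>From the matrix to eigenbasis coordinates\<close>

text \<open>For square matrices a left inverse is a right inverse; here it is the adjoint of the
  matrix with columns \<open>v i\<close>.\<close>

lemma orthonormal_columns_imp_orthonormal_rows:
  fixes v :: "nat \<Rightarrow> complex vec"
  assumes car: "\<And>i. 1 \<le> i \<Longrightarrow> i \<le> n \<Longrightarrow> v i \<in> carrier_vec n"
    and orth: "\<And>i j. 1 \<le> i \<Longrightarrow> i \<le> n \<Longrightarrow> 1 \<le> j \<Longrightarrow> j \<le> n \<Longrightarrow> v i \<bullet>c v j = (if i = j then 1 else 0)"
    and pq: "p < n" "q < n"
  shows "(\<Sum>i=1..n. v i $ p * cnj (v i $ q)) = (if p = q then 1 else 0)"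
proof -
  define V where "V = mat n n (\<lambda>(p, i). v (Suc i) $ p)"
  define W where "W = mat n n (\<lambda>(i, q). cnj (v (Suc i) $ q))"
  have V: "V \<in> carrier_mat n n" and W: "W \<in> carrier_mat n n" by (simp_all add: V_def W_def)
  have "W * V = 1\<^sub>m n"
  proof (rule eq_matI)
    fix i j assume ij: "i < dim_row (1\<^sub>m n :: complex mat)" "j < dim_col (1\<^sub>m n :: complex mat)"
    then have "(W * V) $$ (i, j) = v (Suc j) \<bullet>c v (Suc i)"
      using car[of "Suc i"] by (auto simp: V_def W_def scalar_prod_def mult.commute intro!: sum.cong)
    then show "(W * V) $$ (i, j) = 1\<^sub>m n $$ (i, j)" using orth[of "Suc j" "Suc i"] ij by auto
  qed (use V W in auto)
  then have VW: "V * W = 1\<^sub>m n" using mat_mult_left_right_inverse[OF W V] by simp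
  have "(\<Sum>i=1..n. v i $ p * cnj (v i $ q)) = (\<Sum>i<n. v (Suc i) $ p * cnj (v (Suc i) $ q))"
    by (rule sum.reindex_bij_witness[of _ Suc "\<lambda>m. m - 1"]) auto
  also have "\<dots> = (V * W) $$ (p, q)"
    using pq by (auto simp: V_def W_def scalar_prod_def atLeast0LessThan intro!: sum.cong)
  also have "\<dots> = (if p = q then 1 else 0)" unfolding VW using pq by simp
  finally show ?thesis .
qed

text \<open>Eigenvectors of the submatrix, padded by a zero at position \<open>k\<close>, are
  expanded in the basis \<open>v\<close>. This unitary change of coordinates keeps inner products
  and turns the form of \<open>A\<close> into the diagonal one with weights
  \<open>lam\<close>.\<close>

lemma principal_submatrix_coordinates:
  fixes A :: "complex mat" and lam mu :: "nat \<Rightarrow> real" and v :: "nat \<Rightarrow> complex vec"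
  assumes A: "A \<in> carrier_mat n n" "hermitian_mat A"
    and car: "\<And>i. 1 \<le> i \<Longrightarrow> i \<le> n \<Longrightarrow> v i \<in> carrier_vec n"
    and eigen: "\<And>i. 1 \<le> i \<Longrightarrow> i \<le> n \<Longrightarrow> A *\<^sub>v v i = complex_of_real (lam i) \<cdot>\<^sub>v v i"
    and orth: "\<And>i j. 1 \<le> i \<Longrightarrow> i \<le> n \<Longrightarrow> 1 \<le> j \<Longrightarrow> j \<le> n \<Longrightarrow> v i \<bullet>c v j = (if i = j then 1 else 0)"
    and k: "1 \<le> k" "k \<le> n"
    and mu: "char_poly (principal_del A k) = (\<Prod>j = 1..n - 1. [:- complex_of_real (mu j), 1:])"
  shows "\<exists>a. (\<forall>p\<in>{1..<n}. \<forall>q\<in>{1..<n}. cip {1..n} (a p) (a q) = (if p = q then 1 else 0)) \<and>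
             (\<forall>p\<in>{1..<n}. \<forall>q\<in>{1..<n}. (\<Sum>i=1..n. of_real (lam i) * a p i * cnj (a q i)) = (if p = q then of_real (mu p) else 0)) \<and>
             (\<forall>p\<in>{1..<n}. (\<Sum>i=1..n. a p i * v i $ (k - 1)) = 0)"
proof -
  define N where "N = n - 1"
  define M where "M = principal_del A k"
  \<comment> \<open>Embeds the 0-based indices of the submatrix into those of \<open>A\<close>,
    skipping \<open>k - 1\<close>.\<close>
  define \<iota> where "\<iota> s = (if s < k - 1 then s else Suc s)" for s
  have \<iota>: "\<iota> s < n" "\<iota> s \<noteq> k - 1" if "s < N" for s using that k by (auto simp: \<iota>_def N_def)
  have \<iota>_inj: "\<iota> s = \<iota> s' \<longleftrightarrow> s = s'" for s s' by (auto simp: \<iota>_def)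
  have M: "M \<in> carrier_mat N N" unfolding M_def principal_del_def N_def by (rule mat_delete_carrier[OF A(1)])
  have M_index: "M $$ (s, s') = A $$ (\<iota> s, \<iota> s')" if "s < N" "s' < N" for s s'
    using that A(1) unfolding M_def principal_del_def mat_delete_def \<iota>_def N_def by auto
  note A_herm = hermitian_mat_index[OF A]
  have M_herm: "M $$ (s, s') = cnj (M $$ (s', s))" if "s < N" "s' < N" for s s'
    unfolding M_index[OF that] M_index[OF that(2,1)] using \<iota> that by (intro A_herm) auto
  obtain u where u_orth: "\<And>p q. p \<in> {1..N} \<Longrightarrow> q \<in> {1..N} \<Longrightarrow> cip {..<N} (u p) (u q) = (if p = q then 1 else 0)"
    and u_eig: "\<And>p s. p \<in> {1..N} \<Longrightarrow> s < N \<Longrightarrow> (\<Sum>s'<N. M $$ (s, s') * u p s') = of_real (mu p) * u p s"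
    using hermitian_orthonormal_eigenvectors[OF M M_herm mu[folded M_def N_def]] by blast
  have rows: "(\<Sum>i=1..n. v i $ p * cnj (v i $ q)) = (if p = q then 1 else 0)" if "p < n" "q < n" for p q
    by (rule orthonormal_columns_imp_orthonormal_rows[OF car orth that])
  \<comment> \<open>The spectral decomposition of \<open>A\<close>, entry by entry: replace
    \<open>lam i\<close> times \<open>v i\<close> by \<open>A\<close> applied to \<open>v i\<close>,
    then use orthonormality of the rows.\<close>
  have A_spec: "(\<Sum>i=1..n. of_real (lam i) * (v i $ p * cnj (v i $ q))) = A $$ (p, q)" if pq: "p < n" "q < n" for p q
  proof -
    have "of_real (lam i) * v i $ p = (\<Sum>s<n. A $$ (p, s) * v i $ s)" if i: "i \<in> {1..n}" for i
    proof -
      have "(A *\<^sub>v v i) $ p = (\<Sum>s<n. A $$ (p, s) * v i $ s)"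
        using car[of i] A(1) i pq by (auto simp: scalar_prod_def atLeast0LessThan intro!: sum.cong)
      then show ?thesis using eigen[of i] car[of i] i pq by auto
    qed
    then have "(\<Sum>i=1..n. of_real (lam i) * (v i $ p * cnj (v i $ q)))
        = (\<Sum>i=1..n. \<Sum>s<n. A $$ (p, s) * (v i $ s * cnj (v i $ q)))"
      unfolding mult.assoc[symmetric] by (intro sum.cong refl) (simp add: sum_distrib_right)
    also have "\<dots> = (\<Sum>s<n. A $$ (p, s) * (\<Sum>i=1..n. v i $ s * cnj (v i $ q)))"
      unfolding sum_distrib_left by (rule sum.swap)
    also have "\<dots> = (\<Sum>s<n. if s = q then A $$ (p, s) else 0)"
      using pq by (intro sum.cong refl) (auto simp: rows simp del: One_nat_def)
    also have "\<dots> = A $$ (p, q)" using pq by simp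
    finally show ?thesis .
  qed
  define a where "a p i = (\<Sum>s<N. u p s * cnj (v i $ \<iota> s))" for p i
  \<comment> \<open>One computation serves two weights: with \<open>w = 1\<close> the inner sum
    collapses by \<open>rows\<close>, with \<open>w = lam\<close> it is an entry of \<open>A\<close>
    by \<open>A_spec\<close>.\<close>
  have expand: "(\<Sum>i=1..n. of_real (w i) * a p i * cnj (a q i))
      = (\<Sum>s'<N. (\<Sum>s<N. (\<Sum>i=1..n. of_real (w i) * (v i $ \<iota> s' * cnj (v i $ \<iota> s))) * u p s) * cnj (u q s'))"
    for w :: "nat \<Rightarrow> real" and p q
  proof -
    have "(\<Sum>i=1..n. of_real (w i) * a p i * cnj (a q i))
       = (\<Sum>i=1..n. \<Sum>s'<N. \<Sum>s<N. of_real (w i) * (v i $ \<iota> s' * cnj (v i $ \<iota> s)) * u p s * cnj (u q s'))"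
      unfolding a_def cnj_sum complex_cnj_mult complex_cnj_cnj mult.assoc sum_product
      unfolding sum_distrib_left by (subst (2) sum.swap) (simp only: mult_ac)
    also have "\<dots> = (\<Sum>s'<N. \<Sum>s<N. \<Sum>i=1..n. of_real (w i) * (v i $ \<iota> s' * cnj (v i $ \<iota> s)) * u p s * cnj (u q s'))"
      by (rule trans[OF sum.swap], rule sum.cong[OF refl], rule sum.swap)
    finally show ?thesis unfolding sum_distrib_right .
  qed
  have "cip {1..n} (a p) (a q) = (if p = q then 1 else 0)" if pq: "p \<in> {1..<n}" "q \<in> {1..<n}" for p q
  proof -
    have "cip {1..n} (a p) (a q) = (\<Sum>s'<N. (\<Sum>s<N. (\<Sum>i=1..n. v i $ \<iota> s' * cnj (v i $ \<iota> s)) * u p s) * cnj (u q s'))"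
      using expand[of "\<lambda>_. 1" p q] by (simp add: cip_def)
    also have "\<dots> = (\<Sum>s'<N. (\<Sum>s<N. if s = s' then u p s else 0) * cnj (u q s'))"
      using \<iota> by (intro sum.cong refl arg_cong2[where f = "(*)"]) (auto simp: rows \<iota>_inj simp del: One_nat_def)
    also have "\<dots> = cip {..<N} (u p) (u q)" unfolding cip_def by (intro sum.cong) auto
    finally show ?thesis using u_orth pq by (auto simp: N_def)
  qed
  moreover have "(\<Sum>i=1..n. of_real (lam i) * a p i * cnj (a q i)) = (if p = q then of_real (mu p) else 0)"
    if pq: "p \<in> {1..<n}" "q \<in> {1..<n}" for p q
  proof -
    have pN: "p \<in> {1..N}" "q \<in> {1..N}" using pq by (auto simp: N_def)
    have "(\<Sum>i=1..n. of_real (lam i) * a p i * cnj (a q i))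
        = (\<Sum>s'<N. (\<Sum>s<N. M $$ (s', s) * u p s) * cnj (u q s'))"
      unfolding expand using \<iota> by (intro sum.cong refl arg_cong2[where f = "(*)"]) (auto simp: A_spec M_index simp del: One_nat_def)
    also have "\<dots> = (\<Sum>s'<N. of_real (mu p) * u p s' * cnj (u q s'))"
      using u_eig[OF pN(1)] by (intro sum.cong) auto
    also have "\<dots> = of_real (mu p) * cip {..<N} (u p) (u q)"
      unfolding cip_def by (simp add: sum_distrib_left mult.assoc)
    finally show ?thesis using u_orth[OF pN] by simp
  qed
  \<comment> \<open>The sum is the \<open>k\<close>-th entry of a padded vector: row
    \<open>k - 1\<close> is orthogonal to every row \<open>\<iota> s\<close>.\<close>
  moreover have "(\<Sum>i=1..n. a p i * v i $ (k - 1)) = 0" for p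
  proof -
    have "(\<Sum>i=1..n. a p i * v i $ (k - 1)) = (\<Sum>s<N. u p s * (\<Sum>i=1..n. v i $ (k - 1) * cnj (v i $ \<iota> s)))"
      unfolding a_def sum_distrib_left sum_distrib_right by (subst sum.swap) (simp only: mult_ac)
    also have "\<dots> = 0"
    proof (intro sum.neutral ballI)
      fix s assume "s \<in> {..<N}"
      then show "u p s * (\<Sum>i=1..n. v i $ (k - 1) * cnj (v i $ \<iota> s)) = 0"
        using rows[of "k - 1" "\<iota> s"] \<iota>[of s] k by auto
    qed
    finally show ?thesis .
  qed
  ultimately show ?thesis by blast
qed

section \<open>Both inequalities for the principal submatrix\<close>

theorem theorem3p3:
  fixes A :: "complex mat" and n k :: nat
    and lam :: "nat \<Rightarrow> real" and v :: "nat \<Rightarrow> complex vec" and mu :: "nat \<Rightarrow> real"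
  assumes n2: "n \<ge> 2"
    and A_carrier: "A \<in> carrier_mat n n"
    and A_herm: "hermitian_mat A"
    and lam_sorted: "\<And>i j. 1 \<le> i \<Longrightarrow> i \<le> j \<Longrightarrow> j \<le> n \<Longrightarrow> lam j \<le> lam i"
    and v_carrier: "\<And>i. 1 \<le> i \<Longrightarrow> i \<le> n \<Longrightarrow> v i \<in> carrier_vec n"
    and v_eigen: "\<And>i. 1 \<le> i \<Longrightarrow> i \<le> n \<Longrightarrow> A *\<^sub>v v i = complex_of_real (lam i) \<cdot>\<^sub>v v i"
    and v_orthonormal: "\<And>i j. 1 \<le> i \<Longrightarrow> i \<le> n \<Longrightarrow> 1 \<le> j \<Longrightarrow> j \<le> n \<Longrightarrow>
                          v i \<bullet>c v j = (if i = j then 1 else 0)"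
    and k_range: "1 \<le> k" "k \<le> n"
    and mu_sorted: "\<And>i j. 1 \<le> i \<Longrightarrow> i \<le> j \<Longrightarrow> j \<le> n - 1 \<Longrightarrow> mu j \<le> mu i"
    and mu_eigs: "char_poly (principal_del A k) = (\<Prod>j = 1..n - 1. [:- complex_of_real (mu j), 1:])"
  shows "\<forall>l r. 1 \<le> l \<and> l \<le> r \<and> r \<le> n - 1
           \<and> (\<Sum>i = l..n. (cmod (v i $ (k - 1)))\<^sup>2) \<noteq> 0
           \<and> (\<Sum>i = 1..r + 1. (cmod (v i $ (k - 1)))\<^sup>2) \<noteq> 0 \<longrightarrow>
           (let U = (\<Sum>i = l..n. (cmod (v i $ (k - 1)))\<^sup>2);
                L = (\<Sum>i = 1..r + 1. (cmod (v i $ (k - 1)))\<^sup>2)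
            in (\<Sum>j = l..r. lam (j + 1))
                 + (\<Sum>j = l..r. (cmod (v (j + 1) $ (k - 1)))\<^sup>2 / L * (lam l - lam (j + 1)))
               \<le> (\<Sum>j = l..r. mu j)
             \<and> (\<Sum>j = l..r. mu j)
               \<le> (\<Sum>j = l..r. lam j)
                 - (\<Sum>j = l..r. (cmod (v j $ (k - 1)))\<^sup>2 / U * (lam j - lam (r + 1))))"
proof (intro allI impI)
  fix l r
  assume asm: "1 \<le> l \<and> l \<le> r \<and> r \<le> n - 1
           \<and> (\<Sum>i = l..n. (cmod (v i $ (k - 1)))\<^sup>2) \<noteq> 0
           \<and> (\<Sum>i = 1..r + 1. (cmod (v i $ (k - 1)))\<^sup>2) \<noteq> 0"
  then have lr: "1 \<le> l" "l \<le> r" "r < n" using n2 by auto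
  define b where "b i = v i $ (k - 1)" for i
  obtain a where
      a_orth: "\<And>p q. p \<in> {1..<n} \<Longrightarrow> q \<in> {1..<n} \<Longrightarrow> cip {1..n} (a p) (a q) = (if p = q then 1 else 0)"
    and a_diag: "\<And>p q. p \<in> {1..<n} \<Longrightarrow> q \<in> {1..<n} \<Longrightarrow>
                 (\<Sum>i=1..n. of_real (lam i) * a p i * cnj (a q i)) = (if p = q then of_real (mu p) else 0)"
    and a_annih: "\<And>p. p \<in> {1..<n} \<Longrightarrow> (\<Sum>i=1..n. a p i * b i) = 0"
    using principal_submatrix_coordinates[OF A_carrier A_herm v_carrier v_eigen v_orthonormal k_range mu_eigs]
    unfolding b_def by blast
  have U0: "(\<Sum>i=l..n. (cmod (b i))\<^sup>2) \<noteq> 0" and L0: "(\<Sum>i=1..r + 1. (cmod (b i))\<^sup>2) \<noteq> 0"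
    using asm unfolding b_def by auto
  have mu_sorted': "mu j \<le> mu i" if "1 \<le> i" "i \<le> j" "j < n" for i j using mu_sorted that by simp
  have upper: "(\<Sum>j=l..r. mu j) \<le> (\<Sum>j=l..r. lam j)
           - (\<Sum>j=l..r. (cmod (b j))\<^sup>2 / (\<Sum>i=l..n. (cmod (b i))\<^sup>2) * (lam j - lam (r + 1)))"
    by (rule compression_partial_sum_upper_bound[OF a_orth a_diag a_annih lam_sorted mu_sorted' lr U0])

  \<comment> \<open>Negating \<open>A\<close> reverses the order of both spectra.\<close>
  have flip_n: "(\<Sum>i=1..n. g (n + 1 - i)) = (\<Sum>i=1..n. g i)" for g :: "nat \<Rightarrow> complex"
    by (rule sum.reindex_bij_witness[of _ "\<lambda>i. n + 1 - i" "\<lambda>i. n + 1 - i"]) auto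
  have flip_lr: "(\<Sum>j=n - r..n - l. g (n - j)) = (\<Sum>j=l..r. g j)" for g :: "nat \<Rightarrow> real"
    using lr by (intro sum.reindex_bij_witness[of _ "\<lambda>i. n - i" "\<lambda>i. n - i"]) auto
  have flip_lr1: "(\<Sum>j=n - r..n - l. g (n + 1 - j)) = (\<Sum>j=l..r. g (j + 1))" for g :: "nat \<Rightarrow> real"
    using lr by (intro sum.reindex_bij_witness[of _ "\<lambda>i. n - i" "\<lambda>i. n - i"]) (auto intro!: arg_cong[of _ _ g])
  have flip_L: "(\<Sum>i=n - r..n. (cmod (b (n + 1 - i)))\<^sup>2) = (\<Sum>i=1..r + 1. (cmod (b i))\<^sup>2)"
    using lr by (intro sum.reindex_bij_witness[of _ "\<lambda>i. n + 1 - i" "\<lambda>i. n + 1 - i"]) auto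
  \<comment> \<open>There are \<open>n\<close> values \<open>lam\<close> but only
    \<open>n - 1\<close> values \<open>mu\<close>, so they reflect by \<open>n + 1 - j\<close> and
    \<open>n - j\<close>. This mismatch produces the shift to \<open>lam (j + 1)\<close>, while the
    sum \<open>U\<close> for the reflected data becomes \<open>L\<close>.\<close>
  have "(\<Sum>j=n - r..n - l. - mu (n - j)) \<le> (\<Sum>j=n - r..n - l. - lam (n + 1 - j))
           - (\<Sum>j=n - r..n - l. (cmod (b (n + 1 - j)))\<^sup>2 / (\<Sum>i=n - r..n. (cmod (b (n + 1 - i)))\<^sup>2)
                * (- lam (n + 1 - j) - - lam (n + 1 - (n - l + 1))))"
  proof (rule compression_partial_sum_upper_bound[where a = "\<lambda>p i. a (n - p) (n + 1 - i)"])
    fix p q assume pq: "p \<in> {1..<n}" "q \<in> {1..<n}"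
    then have npq: "n - p \<in> {1..<n}" "n - q \<in> {1..<n}" "n - p = n - q \<longleftrightarrow> p = q" by auto
    show "cip {1..n} (\<lambda>i. a (n - p) (n + 1 - i)) (\<lambda>i. a (n - q) (n + 1 - i)) = (if p = q then 1 else 0)"
      using a_orth[OF npq(1,2)] flip_n[of "\<lambda>i. a (n - p) i * cnj (a (n - q) i)"]
      unfolding cip_def npq(3) by simp
    show "(\<Sum>i=1..n. of_real (- lam (n + 1 - i)) * a (n - p) (n + 1 - i) * cnj (a (n - q) (n + 1 - i)))
        = (if p = q then of_real (- mu (n - p)) else 0)"
      using a_diag[OF npq(1,2)] flip_n[of "\<lambda>i. of_real (lam i) * a (n - p) i * cnj (a (n - q) i)"]
      unfolding npq(3) by (simp add: sum_negf)
  next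
    fix p assume "p \<in> {1..<n}"
    then have "n - p \<in> {1..<n}" by auto
    then show "(\<Sum>i=1..n. a (n - p) (n + 1 - i) * b (n + 1 - i)) = 0"
      using a_annih flip_n[of "\<lambda>i. a (n - p) i * b i"] by simp
  next
    show "(\<Sum>i=n - r..n. (cmod (b (n + 1 - i)))\<^sup>2) \<noteq> 0" unfolding flip_L by (rule L0)
  qed (use lr lam_sorted mu_sorted' in auto)
  then have "(\<Sum>j=l..r. - mu j) \<le> (\<Sum>j=l..r. - lam (j + 1))
      - (\<Sum>j=l..r. (cmod (b (j + 1)))\<^sup>2 / (\<Sum>i=1..r + 1. (cmod (b i))\<^sup>2) * (- lam (j + 1) - - lam (n + 1 - (n - l + 1))))"
    unfolding flip_lr[of "\<lambda>j. - mu j"] flip_lr1[of "\<lambda>j. - lam j"] flip_L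
      flip_lr1[of "\<lambda>j. (cmod (b j))\<^sup>2 / (\<Sum>i=1..r + 1. (cmod (b i))\<^sup>2) * (- lam j - - lam (n + 1 - (n - l + 1)))"] .
  \<comment> \<open>The reference eigenvalue lies one past the reflected upper end
    \<open>n - l\<close>; reflecting it back gives \<open>lam l\<close>.\<close>
  moreover have "n + 1 - (n - l + 1) = l" using lr by simp
  ultimately have lower: "(\<Sum>j=l..r. lam (j + 1))
      + (\<Sum>j=l..r. (cmod (b (j + 1)))\<^sup>2 / (\<Sum>i=1..r + 1. (cmod (b i))\<^sup>2) * (lam l - lam (j + 1))) \<le> (\<Sum>j=l..r. mu j)"
    by (simp add: sum_negf)
  show "let U = (\<Sum>i = l..n. (cmod (v i $ (k - 1)))\<^sup>2);
                L = (\<Sum>i = 1..r + 1. (cmod (v i $ (k - 1)))\<^sup>2)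
            in (\<Sum>j = l..r. lam (j + 1))
                 + (\<Sum>j = l..r. (cmod (v (j + 1) $ (k - 1)))\<^sup>2 / L * (lam l - lam (j + 1)))
               \<le> (\<Sum>j = l..r. mu j)
             \<and> (\<Sum>j = l..r. mu j)
               \<le> (\<Sum>j = l..r. lam j)
                 - (\<Sum>j = l..r. (cmod (v j $ (k - 1)))\<^sup>2 / U * (lam j - lam (r + 1)))"
    using lower upper unfolding Let_def b_def by blast
qed

end
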